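(* Let $Y$ be a real topological vector space, $F\subset Y$, $D$ a nonempty closed proper subset of $Y$, $k\in0^+D\setminus\{0\}$, and suppose $D+\mathbb{R}_>k\subseteq\operatorname{int}D$. Then $$\operatorname{WEff}(F,D)=\{y^0\in F\mid\forall y\in(F\cap\operatorname{dom}\varphi_{y^0-D,k})\setminus\{y^0\}:\ \varphi_{y^0-D,k}(y)\ge0\}$$ $$=\{y^0\in F\mid\forall y\in(F\cap\operatorname{dom}\varphi_{y^0-D,k})\setminus\{y^0\}:\ \varphi_{-D,k}(y-y^0)\ge0\}.$$ If $0\in D$, then $\varphi_{y^0-D,k}(y^0)=\varphi_{-D,k}(y^0-y^0)\le0$ for each $y^0\in Y$. If $0\in\operatorname{bd}D$, then $\varphi_{y^0-D,k}(y^0)=\varphi_{-D,k}(y^0-y^0)=0$ for each $y^0\in Y$, and $$\operatorname{WEff}(F,D)=\{y^0\in F\mid\varphi_{y^0-D,k}(y^0)=\min_{y\in F}\varphi_{y^0-D,k}(y)\}=\{y^0\in F\mid\varphi_{-D,k}(y^0-y^0)=\min_{y\in F}\varphi_{-D,k}(y-y^0)\}.$$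
   Context: $\mathbb{R}_+=\{x\in\mathbb{R}\mid x\ge0\}$, $\mathbb{R}_>=\{x\in\mathbb{R}\mid x>0\}$; $0^+D:=\{u\in Y\mid\forall d\in D\ \forall t\in\mathbb{R}_+: d+tu\in D\}$ is the recession cone. $\operatorname{Eff}(F,D):=\{y^0\in F\mid F\cap(y^0-D)\subseteq\{y^0\}\}$ and $\operatorname{WEff}(F,D):=\operatorname{Eff}(F,\operatorname{int}D)$. For $a\in Y$, define $\varphi_{a-D,k}(y):=\inf\{t\in\mathbb{R}\mid y\in a-D+tk\}$ for $y\in Y$, where $\inf\emptyset:=\nu$ is a symbol outside the extended reals marking infeasibility, and $\operatorname{dom}\varphi_{a-D,k}:=\{y\in Y\mid\varphi_{a-D,k}(y)\in\mathbb{R}\cup\{-\infty\}\}=a-D+\mathbb{R}k$. $\varphi_{-D,k}$ stands for $\varphi_{0-D,k}$. A minimum over $F$ of such a functional is taken over the feasible points only, i.e. over those $y\in F$ at which the functional does not have the value $\nu$. *)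

theory Defs
  imports "HOL-Analysis.Analysis"
begin

text \<open>Topological vector spaces over the reals; no separation axiom is assumed.\<close>

class real_topological_vector_space = topological_group_add + real_vector +
  assumes tendsto_scaleR_nhds:
    "LIM p (nhds c \<times>\<^sub>F nhds x). fst p *\<^sub>R snd p :> nhds (c *\<^sub>R x)"

instance real_normed_vector \<subseteq> real_topological_vector_space
proof
  fix c :: real and x :: 'a
  show "LIM p (nhds c \<times>\<^sub>F nhds x). fst p *\<^sub>R snd p :> nhds (c *\<^sub>R x)"
    by (intro tendsto_scaleR filterlim_fst filterlim_snd)
qed

definition recession_cone :: "'a::real_vector set \<Rightarrow> 'a set" where
  "recession_cone D = {u. \<forall>d\<in>D. \<forall>t\<ge>0. d + t *\<^sub>R u \<in> D}"

definition Eff :: "'a::ab_group_add set \<Rightarrow> 'a set \<Rightarrow> 'a set" where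
  "Eff F D = {y0 \<in> F. F \<inter> (\<lambda>d. y0 - d) ` D \<subseteq> {y0}}"

definition WEff :: "'a::{ab_group_add,topological_space} set \<Rightarrow> 'a set \<Rightarrow> 'a set" where
  "WEff F D = Eff F (interior D)"

text \<open>
  Functionals with values in the extended reals or the infeasibility symbol \<open>\<nu>\<close>:
  \<open>None\<close> stands for \<open>\<nu>\<close>. In particular the infimum of the empty set is \<open>None\<close>,
  not \<open>Some \<infinity>\<close>.
\<close>

definition inf_nu :: "real set \<Rightarrow> ereal option" where
  "inf_nu T = (if T = {} then None else Some (INF t\<in>T. ereal t))"

text \<open>\<open>phi a D k\<close> is the functional \<open>\<phi>\<close> with subscript \<open>a - D, k\<close>; for \<open>- D, k\<close> take \<open>a = 0\<close>.\<close>

definition phi :: "'a::real_vector \<Rightarrow> 'a set \<Rightarrow> 'a \<Rightarrow> 'a \<Rightarrow> ereal option" where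
  "phi a D k y = inf_nu {t. y \<in> (\<lambda>d. a - d + t *\<^sub>R k) ` D}"

definition dom_nu :: "('a \<Rightarrow> ereal option) \<Rightarrow> 'a set" where
  "dom_nu f = {y. f y \<in> Some ` (range ereal \<union> {-\<infinity>})}"

lemma inf_nu_mem: "inf_nu T \<in> Some ` (range ereal \<union> {-\<infinity>}) \<longleftrightarrow> T \<noteq> {}"
proof (cases "T = {}")
  case False
  then obtain t where "t \<in> T" by blast
  then have "(INF t\<in>T. ereal t) \<le> ereal t" by (rule INF_lower)
  then have "(INF t\<in>T. ereal t) \<in> range ereal \<union> {-\<infinity>}"
    by (cases "INF t\<in>T. ereal t") auto
  then have "inf_nu T \<in> Some ` (range ereal \<union> {-\<infinity>})"
    unfolding inf_nu_def using False by (simp only: if_False imageI)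
  then show ?thesis using False by blast
qed (simp add: inf_nu_def image_iff)

lemma dom_phi: "dom_nu (phi a D k) = {a - d + t *\<^sub>R k | d t. d \<in> D}"
  unfolding dom_nu_def phi_def inf_nu_mem by blast

text \<open>The order of the extended reals; \<open>\<nu>\<close> is not comparable to anything, itself included.\<close>

fun le_nu :: "ereal option \<Rightarrow> ereal option \<Rightarrow> bool" (infix "\<le>\<^sub>\<nu>" 50) where
  "Some u \<le>\<^sub>\<nu> Some v \<longleftrightarrow> u \<le> v"
| "_ \<le>\<^sub>\<nu> _ \<longleftrightarrow> False"

text \<open>
  \<open>is_min_nu f F m\<close>: the minimum of \<open>f\<close> over the feasible points of \<open>F\<close> is attained and equals
  \<open>m\<close>. A relation, because the minimum need not exist.
\<close>

definition is_min_nu :: "('a \<Rightarrow> ereal option) \<Rightarrow> 'a set \<Rightarrow> ereal option \<Rightarrow> bool" where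
  "is_min_nu f F m \<longleftrightarrow>
     m \<in> f ` {y \<in> F. f y \<noteq> None} \<and> (\<forall>y\<in>{y \<in> F. f y \<noteq> None}. m \<le>\<^sub>\<nu> f y)"

end

theory Submission
  imports Defs
begin

text \<open>
  A point \<open>y\<close> lies in \<open>a - D + t k\<close> precisely when \<open>(a - y) + t k \<in> D\<close>. Hence \<open>\<phi>\<close> with subscript
  \<open>a - D, k\<close> evaluated at \<open>y\<close> is the infimum of the parameters at which the line through \<open>a - y\<close> in
  direction \<open>k\<close> meets \<open>D\<close> (\<open>phi_eq\<close>); it depends on \<open>y - a\<close> only, which makes the two
  versions of every assertion equivalent.

  Everything else follows from one equivalence: this infimum is negative if and only if
  \<open>a - y \<in> int D\<close> (\<open>zero_le_phi_iff\<close>). A negative parameter \<open>t\<close> in the set puts \<open>a - y\<close> into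
  \<open>D + (-t) k\<close>, which lies in \<open>int D\<close> by assumption; and from an interior point one can move a little in
  direction \<open>-k\<close> without leaving \<open>D\<close>. Weak efficiency of \<open>y\<^sup>0\<close> means that no \<open>y \<in> F\<close> other than \<open>y\<^sup>0\<close>
  has \<open>y\<^sup>0 - y \<in> int D\<close>, so it means that \<open>\<phi>\<close> is nonnegative at all such feasible \<open>y\<close>. If \<open>0\<close> is a
  boundary point of \<open>D\<close>, then the value at \<open>y\<^sup>0\<close> itself is \<open>0\<close>, and nonnegativity becomes minimality
  at \<open>y\<^sup>0\<close>.
\<close>

lemma phi_eq: "phi a D k y = inf_nu {t. a - y + t *\<^sub>R k \<in> D}"
proof -
  have "y \<in> (\<lambda>d. a - d + t *\<^sub>R k) ` D \<longleftrightarrow> a - y + t *\<^sub>R k \<in> D" for t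
  proof
    assume "y \<in> (\<lambda>d. a - d + t *\<^sub>R k) ` D"
    then show "a - y + t *\<^sub>R k \<in> D" by auto
  next
    assume "a - y + t *\<^sub>R k \<in> D"
    then show "y \<in> (\<lambda>d. a - d + t *\<^sub>R k) ` D"
      by (intro image_eqI[where x = "a - y + t *\<^sub>R k"]) auto
  qed
  then show ?thesis by (simp add: phi_def)
qed

lemma phi_translate: "phi 0 D k (y - a) = phi a D k y"
  by (simp add: phi_eq)

text \<open>
  Continuity of scalar multiplication at \<open>(0, k)\<close> gives \<open>t k \<rightarrow> 0\<close> as \<open>t \<rightarrow> 0\<close>, so \<open>z + t k\<close> stays in
  the open set \<open>int D\<close> for small \<open>t\<close> of either sign.
\<close>

lemma interior_step_back:
  fixes z k :: "'a::real_topological_vector_space"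
  assumes "z \<in> interior D"
  obtains t :: real where "t < 0" "z + t *\<^sub>R k \<in> D"
proof -
  have "filterlim (\<lambda>t. (t, k)) (nhds (0::real) \<times>\<^sub>F nhds k) (nhds 0)"
    by (intro filterlim_Pair filterlim_ident tendsto_const)
  from filterlim_compose[OF tendsto_scaleR_nhds this]
  have "((\<lambda>t. t *\<^sub>R k) \<longlongrightarrow> 0) (nhds (0::real))" by simp
  from tendsto_add[OF tendsto_const[of z] this]
  have "((\<lambda>t. z + t *\<^sub>R k) \<longlongrightarrow> z) (nhds (0::real))" by simp
  then have "eventually (\<lambda>t. z + t *\<^sub>R k \<in> interior D) (nhds (0::real))"
    using assms by (intro topological_tendstoD) auto
  then obtain e :: real where "e > 0" and e: "\<And>t. dist t 0 < e \<Longrightarrow> z + t *\<^sub>R k \<in> interior D"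
    by (auto simp: eventually_nhds_metric)
  show ?thesis
  proof (rule that)
    show "- e / 2 < 0" using \<open>e > 0\<close> by simp
    show "z + (- e / 2) *\<^sub>R k \<in> D"
      using e[of "- e / 2"] \<open>e > 0\<close> interior_subset[of D] by auto
  qed
qed

text \<open>
  The link between order and topology: a feasible value fails to be nonnegative exactly when the line
  through \<open>a - y\<close> meets \<open>D\<close> at a negative parameter, and this is what \<open>a - y \<in> int D\<close> amounts to.
\<close>

lemma zero_le_phi_iff:
  fixes k :: "'a::real_topological_vector_space"
  assumes "{d + t *\<^sub>R k | d t. d \<in> D \<and> t > 0} \<subseteq> interior D"
  shows "Some 0 \<le>\<^sub>\<nu> phi a D k y \<longleftrightarrow> phi a D k y \<noteq> None \<and> a - y \<notin> interior D"
proof -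
  let ?T = "{t. a - y + t *\<^sub>R k \<in> D}"
  have "a - y \<in> interior D \<longleftrightarrow> (\<exists>t\<in>?T. t < 0)"
  proof
    assume "a - y \<in> interior D"
    then show "\<exists>t\<in>?T. t < 0" by (rule interior_step_back[where k = k]) auto
  next
    assume "\<exists>t\<in>?T. t < 0"
    then obtain t where t: "a - y + t *\<^sub>R k \<in> D" "t < 0" by blast
    have "a - y = (a - y + t *\<^sub>R k) + (- t) *\<^sub>R k" by simp
    moreover have "- t > 0" using t(2) by simp
    ultimately show "a - y \<in> interior D" using t(1) assms by blast
  qed
  moreover have "(0 \<le> (INF t\<in>?T. ereal t)) \<longleftrightarrow> \<not> (\<exists>t\<in>?T. t < 0)"
    by (auto simp: le_INF_iff not_less)
  ultimately show ?thesis by (auto simp: phi_eq inf_nu_def)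
qed

lemma dom_nu_phi_iff: "y \<in> dom_nu (phi a D k) \<longleftrightarrow> phi a D k y \<noteq> None"
  unfolding dom_nu_def mem_Collect_eq by (subst (1) phi_def, subst inf_nu_mem)
    (auto simp: phi_def inf_nu_def)

lemma WEff_iff:
  "y0 \<in> WEff F D \<longleftrightarrow> y0 \<in> F \<and> (\<forall>y\<in>F - {y0}. y0 - y \<notin> interior D)"
proof -
  have "y \<in> (\<lambda>d. y0 - d) ` interior D \<longleftrightarrow> y0 - y \<in> interior D" for y
    by (auto intro: image_eqI[where x = "y0 - y"])
  then show ?thesis unfolding WEff_def Eff_def by blast
qed

lemma phi_self_le_zero:
  assumes "0 \<in> D"
  shows "phi a D k a \<le>\<^sub>\<nu> Some 0"
proof -
  let ?T = "{t::real. t *\<^sub>R k \<in> D}"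
  have zero: "0 \<in> ?T" using assms by simp
  then have "(INF t\<in>?T. ereal t) \<le> ereal 0" by (rule INF_lower)
  moreover have "?T \<noteq> {}" using zero by blast
  ultimately show ?thesis by (simp add: phi_eq inf_nu_def zero_ereal_def)
qed

lemma le_nu_antisym: "u \<le>\<^sub>\<nu> v \<Longrightarrow> v \<le>\<^sub>\<nu> u \<Longrightarrow> u = v"
  by (cases u; cases v) auto

lemma phi_self_eq_zero:
  fixes k :: "'a::real_topological_vector_space"
  assumes "{d + t *\<^sub>R k | d t. d \<in> D \<and> t > 0} \<subseteq> interior D"
    and "0 \<in> D" and "0 \<notin> interior D"
  shows "phi a D k a = Some 0"
proof (rule le_nu_antisym)
  show le: "phi a D k a \<le>\<^sub>\<nu> Some 0" using assms(2) by (rule phi_self_le_zero)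
  then have "phi a D k a \<noteq> None" by (cases "phi a D k a") auto
  then show "Some 0 \<le>\<^sub>\<nu> phi a D k a" using assms by (simp add: zero_le_phi_iff)
qed

theorem theorem7:
  fixes F D :: "'a::real_topological_vector_space set" and k :: 'a
  assumes "D \<noteq> {}" and "closed D" and "D \<noteq> UNIV"
    and "k \<in> recession_cone D - {0}"
    and "{d + t *\<^sub>R k | d t. d \<in> D \<and> t > 0} \<subseteq> interior D"
  shows
    "WEff F D = {y0 \<in> F. \<forall>y \<in> (F \<inter> dom_nu (phi y0 D k)) - {y0}. Some 0 \<le>\<^sub>\<nu> phi y0 D k y}
     \<and> WEff F D = {y0 \<in> F. \<forall>y \<in> (F \<inter> dom_nu (phi y0 D k)) - {y0}. Some 0 \<le>\<^sub>\<nu> phi 0 D k (y - y0)}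
     \<and> (0 \<in> D \<longrightarrow>
          (\<forall>y0. phi y0 D k y0 = phi 0 D k (y0 - y0) \<and> phi 0 D k (y0 - y0) \<le>\<^sub>\<nu> Some 0))
     \<and> (0 \<in> frontier D \<longrightarrow>
          (\<forall>y0. phi y0 D k y0 = phi 0 D k (y0 - y0) \<and> phi 0 D k (y0 - y0) = Some 0)
          \<and> WEff F D = {y0 \<in> F. is_min_nu (phi y0 D k) F (phi y0 D k y0)}
          \<and> WEff F D = {y0 \<in> F. is_min_nu (\<lambda>y. phi 0 D k (y - y0)) F (phi 0 D k (y0 - y0))})"
proof -
  note nonneg = zero_le_phi_iff[OF assms(5)]
  \<comment> \<open>An infeasible \<open>y\<close> never violates weak efficiency, since \<open>y0 - y \<in> int D\<close> already gives
    \<open>0\<close> as a parameter; so restricting to the domain loses nothing.\<close>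
  have feasible: "y \<in> dom_nu (phi a D k)" if "a - y \<in> interior D" for a y
  proof -
    have "a - y + 0 *\<^sub>R k \<in> D" using that interior_subset[of D] by auto
    then have "{t. a - y + t *\<^sub>R k \<in> D} \<noteq> {}" by blast
    then show ?thesis by (simp add: dom_nu_phi_iff phi_eq inf_nu_def)
  qed
  have weff: "WEff F D =
      {y0 \<in> F. \<forall>y \<in> (F \<inter> dom_nu (phi y0 D k)) - {y0}. Some 0 \<le>\<^sub>\<nu> phi y0 D k y}"
    using feasible unfolding set_eq_iff mem_Collect_eq WEff_iff nonneg dom_nu_phi_iff[symmetric] by blast
  have minimal: "WEff F D = {y0 \<in> F. is_min_nu (phi y0 D k) F (phi y0 D k y0)}"
    and self: "phi y0 D k y0 = Some 0" if "0 \<in> frontier D" for y0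
  proof -
    have "0 \<in> D" and "0 \<notin> interior D"
      using that \<open>closed D\<close> by (auto simp: frontier_def)
    then have self: "phi y0 D k y0 = Some 0" for y0
      using assms(5) by (intro phi_self_eq_zero)
    then show "phi y0 D k y0 = Some 0" .
    have "is_min_nu (phi y0 D k) F (phi y0 D k y0) \<longleftrightarrow>
        (\<forall>y \<in> (F \<inter> dom_nu (phi y0 D k)) - {y0}. Some 0 \<le>\<^sub>\<nu> phi y0 D k y)" if "y0 \<in> F" for y0
    proof -
      have "phi y0 D k y0 \<in> phi y0 D k ` {y \<in> F. phi y0 D k y \<noteq> None}"
        using that self[of y0] by (intro imageI) simp
      moreover have "Some 0 \<le>\<^sub>\<nu> phi y0 D k y0" by (simp add: self)
      ultimately show ?thesis
        unfolding is_min_nu_def by (auto simp: self dom_nu_phi_iff simp del: le_nu.simps)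
    qed
    then show "WEff F D = {y0 \<in> F. is_min_nu (phi y0 D k) F (phi y0 D k y0)}"
      using weff by auto
  qed
  show ?thesis
    unfolding phi_translate using weff minimal self phi_self_le_zero by blast
qed

end
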